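(* Let $f:E\to\mathbb{R}$ be $L$-smooth, and let $\psi:E\to\mathbb{R}$ be $\mu$-strongly convex with respect to $\|\cdot\|$, where $\mu>0$. Let $a_i>0$, $A_k=\sum_{i=0}^k a_i$, $H_i>0$, and $\frac{a_i^2}{A_i^2}=c\frac{\mu}{LH_i}$ for all $i\ge1$, where $c\in(0,1)$. Let $\mathbf{x}_0=\mathbf{y}_0=\nabla\psi^*(\mathbf{z}_0)\in E$ be arbitrary and let $\mathbf{x}_k,\mathbf{y}_k,\mathbf{z}_k$ evolve, for $k\ge1$, as $$\mathbf{x}_k=\mathbf{y}_{k-1}+\frac{a_k}{A_k}\nabla\psi^*(\mathbf{z}_{k-1})-\frac{a_k}{A_kA_{k-1}}\sum_{i=0}^{k-1}a_i\nabla\psi^*(\mathbf{z}_i),\qquad \mathbf{z}_k=\mathbf{z}_{k-1}-\frac{a_k}{A_k}H_k\nabla f(\mathbf{x}_k),$$ $$\mathbf{y}_k=\mathrm{argmin}_{\mathbf{u}}\left\{\langle\nabla f(\mathbf{x}_k),\mathbf{u}-\mathbf{x}_k\rangle+\frac{L}{2}\|\mathbf{u}-\mathbf{x}_k\|^2\right\}.$$ (i) If $\frac{\mu}{LH_i}=1$, then for all $k\ge1$, $$\min_{1\le i\le k}\|\nabla f(\mathbf{x}_i)\|_*^2=O\left(\frac{L(f(\mathbf{x}_0)-f(\mathbf{x}^* ))}{c(1-c)k}\right).$$ In particular, for $c=\frac12$, $\min_{1\le i\le k}\|\nabla f(\mathbf{x}_i)\|_*^2=O\left(\frac{L(f(\mathbf{x}_0)-f(\mathbf{x}^*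 ))}{k}\right)$. (ii) If $f$ is convex and $H_i=A_i^\lambda$ with $\lambda\in[0,2]$, then for all $k\ge1$, $$\min_{1\le i\le k}\|\nabla f(\mathbf{x}_i)\|_*^2=O\left(\frac{L(f(\mathbf{x}_0)-f(\mathbf{x}^* ))}{c(1-c)k}\right).$$ In particular, for $c=\frac12$, $\min_{1\le i\le k}\|\nabla f(\mathbf{x}_i)\|_*^2=O\left(\frac{L(f(\mathbf{x}_0)-f(\mathbf{x}^* ))}{k}\right)$.
   Context: $E$ is a finite-dimensional real normed vector space (not necessarily Euclidean) with norm $\|\cdot\|$, dual space $E^*\ni\mathbf{z}_k$, pairing $\langle\mathbf{z},\mathbf{x}\rangle$ and dual norm $\|\mathbf{z}\|_*=\max_{\mathbf{x}\ne0}\langle\mathbf{z},\mathbf{x}\rangle/\|\mathbf{x}\|$. The minimization over $\mathbf{u}$ is over $E$. $f$ is continuously differentiable and possibly nonconvex; $L$-smooth ($L>0$) means $\|\nabla f(\mathbf{x})-\nabla f(\mathbf{y})\|_*\le L\|\mathbf{x}-\mathbf{y}\|$ for all $\mathbf{x},\mathbf{y}\in E$. $\mathbf{x}^*\in\mathrm{argmin}_{\mathbf{x}\in E}f(\mathbf{x})$ is any fixed minimizer. $\psi$ is continuously differentiable and $\mu$-strongly convex: $\psi(\mathbf{y})\ge\psi(\mathbf{x})+\langle\nabla\psi(\mathbf{x}),\mathbf{y}-\mathbf{x}\rangle+\frac\mu2\|\mathbf{y}-\mathbf{x}\|^2$ for all $\mathbf{x},\mathbf{y}\in E$. Its conjugate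 is $\psi^*(\mathbf{z})=\sup_{\mathbf{x}\in E}\{\langle\mathbf{z},\mathbf{x}\rangle-\psi(\mathbf{x})\}$, which is continuously differentiable with $\nabla\psi^*(\mathbf{z})=\mathrm{argmax}_{\mathbf{x}\in E}\{\langle\mathbf{z},\mathbf{x}\rangle-\psi(\mathbf{x})\}$. *)

theory Defs
  imports "HOL-Analysis.Analysis"
begin

text \<open>
  The finite-dimensional normed space \<open>E\<close> is a finite-dimensional subspace, with the induced norm,
  of a normed space \<open>'a\<close>; \<open>E = UNIV\<close> is allowed when \<open>'a\<close> itself is finite-dimensional.
  Having \<open>E\<close> as a set lets a statement bind a constant before \<open>E\<close>, its dimension and its norm:
  every finite-dimensional normed space embeds isometrically into \<open>\<ell>\<^sup>\<infinity>\<close>, i.e. into the type of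
  bounded (continuous) functions \<open>nat \<Rightarrow> real\<close>, so for that \<open>'a\<close> all of them are covered at once.

  Elements of \<open>E\<^sup>*\<close> are represented by bounded linear functionals on \<open>'a\<close>, of which only the
  restriction to \<open>E\<close> matters (by Hahn-Banach every element of \<open>E\<^sup>*\<close> is such a restriction).
  Likewise functions \<open>E \<rightarrow> real\<close> are functions on \<open>'a\<close> that are only examined on \<open>E\<close>.
\<close>

definition finite_dim_subspace :: "'a::real_vector set \<Rightarrow> bool" where
  "finite_dim_subspace E \<longleftrightarrow> (\<exists>B. finite B \<and> span B = E)"

text \<open>
  The point \<open>x = 0\<close> contributes \<open>0 / 0 = 0\<close>. This does not change the supremum if \<open>E \<noteq> {0}\<close>, as
  \<open>E\<close> is symmetric, and it gives the dual norm \<open>0\<close> if \<open>E = {0}\<close>.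
\<close>

definition dual_norm :: "'a::real_normed_vector set \<Rightarrow> ('a \<Rightarrow>\<^sub>L real) \<Rightarrow> real" where
  "dual_norm E z = (SUP x\<in>E. blinfun_apply z x / norm x)"

lemma dual_norm_UNIV: "dual_norm UNIV z = norm z"
proof (rule antisym)
  have le: "blinfun_apply z x / norm x \<le> norm z" for x
  proof (cases "x = 0")
    case False
    have "blinfun_apply z x \<le> norm z * norm x"
      using norm_blinfun[of z x] unfolding real_norm_def by linarith
    with False show ?thesis by (simp add: pos_divide_le_eq)
  qed simp
  then show "dual_norm UNIV z \<le> norm z"
    unfolding dual_norm_def by (intro cSUP_least) simp_all
  have bdd: "bdd_above (range (\<lambda>x. blinfun_apply z x / norm x))"
    using le by (rule bdd_aboveI2)
  have up: "blinfun_apply z x / norm x \<le> dual_norm UNIV z" for x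
    unfolding dual_norm_def by (rule cSUP_upper[OF _ bdd]) simp
  have up': "blinfun_apply z x \<le> dual_norm UNIV z * norm x" for x
    using up[of x] by (cases "x = 0") (simp_all add: pos_divide_le_eq)
  have "norm (blinfun_apply z x) \<le> dual_norm UNIV z * norm x" for x
    using up'[of x] up'[of "- x"] by (simp add: blinfun.minus_right)
  moreover have "0 \<le> dual_norm UNIV z"
    using up[of 0] by simp
  ultimately show "norm z \<le> dual_norm UNIV z"
    by (intro norm_blinfun_bound)
qed

definition has_gradient_on ::
  "('a::real_normed_vector \<Rightarrow> real) \<Rightarrow> ('a \<Rightarrow> ('a \<Rightarrow>\<^sub>L real)) \<Rightarrow> 'a set \<Rightarrow> bool" where
  "has_gradient_on f gf E \<longleftrightarrow>
     (\<forall>x\<in>E. (f has_derivative blinfun_apply (gf x)) (at x within E))"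

text \<open>Continuity of the gradient is continuity with respect to the dual norm of \<open>E\<close>.\<close>

definition C1_on ::
  "('a::real_normed_vector \<Rightarrow> real) \<Rightarrow> ('a \<Rightarrow> ('a \<Rightarrow>\<^sub>L real)) \<Rightarrow> 'a set \<Rightarrow> bool" where
  "C1_on f gf E \<longleftrightarrow> has_gradient_on f gf E \<and>
     (\<forall>x\<in>E. ((\<lambda>y. dual_norm E (gf y - gf x)) \<longlongrightarrow> 0) (at x within E))"

definition L_smooth_on ::
  "real \<Rightarrow> ('a::real_normed_vector \<Rightarrow> real) \<Rightarrow> ('a \<Rightarrow> ('a \<Rightarrow>\<^sub>L real)) \<Rightarrow> 'a set \<Rightarrow> bool" where
  "L_smooth_on L f gf E \<longleftrightarrow> C1_on f gf E \<and>
     (\<forall>x\<in>E. \<forall>y\<in>E. dual_norm E (gf x - gf y) \<le> L * norm (x - y))"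

definition strongly_convex_C1_on ::
  "real \<Rightarrow> ('a::real_normed_vector \<Rightarrow> real) \<Rightarrow> ('a \<Rightarrow> ('a \<Rightarrow>\<^sub>L real)) \<Rightarrow> 'a set \<Rightarrow> bool" where
  "strongly_convex_C1_on \<mu> \<psi> g\<psi> E \<longleftrightarrow> C1_on \<psi> g\<psi> E \<and>
     (\<forall>x\<in>E. \<forall>y\<in>E. \<psi> y \<ge> \<psi> x + blinfun_apply (g\<psi> x) (y - x) + \<mu> / 2 * (norm (y - x))\<^sup>2)"

definition conjugate ::
  "'a::real_normed_vector set \<Rightarrow> ('a \<Rightarrow> real) \<Rightarrow> ('a \<Rightarrow>\<^sub>L real) \<Rightarrow> real" where
  "conjugate E \<psi> z = (SUP x\<in>E. blinfun_apply z x - \<psi> x)"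

text \<open>
  The gradient of the conjugate lives in \<open>E\<^sup>*\<^sup>*\<close>, identified with \<open>E\<close> through evaluation.
\<close>

definition conjugate_gradient ::
  "'a::real_normed_vector set \<Rightarrow> ('a \<Rightarrow> real) \<Rightarrow> (('a \<Rightarrow>\<^sub>L real) \<Rightarrow> 'a) \<Rightarrow> bool" where
  "conjugate_gradient E \<psi> D \<longleftrightarrow>
     (\<forall>z. D z \<in> E \<and> (conjugate E \<psi> has_derivative (\<lambda>w. blinfun_apply w (D z))) (at z))"

text \<open>
  A minimizer defining \<open>y k\<close> need not be unique for a non-Euclidean norm; any choice is allowed.
\<close>

definition momentum_iterates ::
  "'a::real_normed_vector set \<Rightarrow> ('a \<Rightarrow> ('a \<Rightarrow>\<^sub>L real)) \<Rightarrow> real \<Rightarrow> (('a \<Rightarrow>\<^sub>L real) \<Rightarrow> 'a) \<Rightarrow>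
   (nat \<Rightarrow> real) \<Rightarrow> (nat \<Rightarrow> real) \<Rightarrow> (nat \<Rightarrow> real) \<Rightarrow>
   (nat \<Rightarrow> 'a) \<Rightarrow> (nat \<Rightarrow> 'a) \<Rightarrow> (nat \<Rightarrow> ('a \<Rightarrow>\<^sub>L real)) \<Rightarrow> bool" where
  "momentum_iterates E gf L D a A H x y z \<longleftrightarrow>
     x 0 = D (z 0) \<and> y 0 = D (z 0) \<and>
     (\<forall>k\<ge>1.
        x k = y (k - 1) + (a k / A k) *\<^sub>R D (z (k - 1))
              - (a k / (A k * A (k - 1))) *\<^sub>R (\<Sum>i<k. a i *\<^sub>R D (z i)) \<and>
        z k = z (k - 1) - (a k / A k * H k) *\<^sub>R gf (x k) \<and>
        is_arg_min (\<lambda>u. blinfun_apply (gf (x k)) (u - x k) + L / 2 * (norm (u - x k))\<^sup>2)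
          (\<lambda>u. u \<in> E) (y k))"

end

theory Submission
  imports Defs
begin

text \<open>
  The proof is an energy argument. Besides \<open>x\<^sub>k\<close>, \<open>y\<^sub>k\<close>, \<open>z\<^sub>k\<close> it follows the running average
  \<open>w\<^sub>k = (1 / A\<^sub>k) \<Sum>\<^sub>i\<^sub>\<le>\<^sub>k a\<^sub>i D z\<^sub>i\<close>, where \<open>D = \<nabla>\<psi>\<^sup>*\<close>. With \<open>t\<^sub>k = a\<^sub>k / A\<^sub>k\<close>, the recursion for \<open>x\<^sub>k\<close> says that
  \<open>x\<^sub>k = y\<^sub>k\<^sub>-\<^sub>1 + t\<^sub>k (D z\<^sub>k\<^sub>-\<^sub>1 - w\<^sub>k\<^sub>-\<^sub>1)\<close>, so the distance of \<open>D z\<close> from its average is the momentum. Its kinetic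
  energy is the Fenchel gap
  \<open>G\<^sub>k = \<psi> w\<^sub>k + \<psi>\<^sup>* z\<^sub>k - \<langle>z\<^sub>k, w\<^sub>k\<rangle>\<close>, which vanishes at \<open>k = 0\<close> and is at least
  \<open>(\<mu> / 2) \<parallel>w\<^sub>k - D z\<^sub>k\<parallel>\<^sup>2\<close>.

  Write \<open>g\<close> for the gradient of \<open>f\<close> at \<open>x\<^sub>k\<close>. Three estimates are added up. The gradient step from
  \<open>x\<^sub>k\<close> to \<open>y\<^sub>k\<close> decreases \<open>f\<close> by at least \<open>\<parallel>g\<parallel>\<^sub>*\<^sup>2 / (2 L)\<close> (\<open>quadratic_model_min_le\<close>). The momentum step from
  \<open>y\<^sub>k\<^sub>-\<^sub>1\<close> to \<open>x\<^sub>k\<close> increases \<open>f\<close> by at most \<open>t\<^sub>k \<langle>g, D z\<^sub>k\<^sub>-\<^sub>1 - w\<^sub>k\<^sub>-\<^sub>1\<rangle> + e\<close>, where \<open>e = 0\<close> if \<open>f\<close> is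
  convex and \<open>e = (L / 2) t\<^sub>k\<^sup>2 \<parallel>D z\<^sub>k\<^sub>-\<^sub>1 - w\<^sub>k\<^sub>-\<^sub>1\<parallel>\<^sup>2\<close> in general. The gap pays for this inner product:
  since \<open>\<psi>\<^sup>*\<close> is \<open>1 / \<mu>\<close>-smooth, moving the dual variable from \<open>z\<^sub>k\<^sub>-\<^sub>1\<close> to \<open>z\<^sub>k\<close> lowers the gap
  by \<open>H\<^sub>k\<close> times the inner product term, up to \<open>(t\<^sub>k H\<^sub>k \<parallel>g\<parallel>\<^sub>*)\<^sup>2 / (2 \<mu>)\<close>, and since \<open>\<psi>\<close> is convex, averaging
  multiplies it by a further factor of at most \<open>1 - t\<^sub>k\<close>. The coupling \<open>t\<^sub>k\<^sup>2 = c \<mu> / (L H\<^sub>k)\<close> makes the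
  quadratic remainder exactly the fraction \<open>c\<close> of the guaranteed decrease, so that
  \<open>f y\<^sub>k + (1 - c) / (2 L) \<parallel>g\<parallel>\<^sub>*\<^sup>2 \<le> f y\<^sub>k\<^sub>-\<^sub>1 + e + (G\<^sub>k\<^sub>-\<^sub>1 - G\<^sub>k / (1 - t\<^sub>k)) / H\<^sub>k\<close>
  (\<open>momentum_step\<close>). If the gap terms telescope, then summing up bounds the average of the squared
  gradient norms, hence their minimum, by \<open>2 L (f x\<^sub>0 - f x\<^sup>*) / ((1 - c) k)\<close>.

  In the convex case they telescope because \<open>H = A\<^sup>\<lambda>\<close> is nondecreasing. In the nonconvex case \<open>e\<close> is at
  most \<open>c G\<^sub>k\<^sub>-\<^sub>1 / H\<^sub>k\<close>, and the factor \<open>1 / (1 - t\<^sub>k)\<close> absorbs it: there \<open>t\<^sub>k\<^sup>2 = c\<close>, thus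
  \<open>1 + c \<le> 1 + t\<^sub>k \<le> 1 / (1 - t\<^sub>k)\<close>. The asserted bounds hold with the absolute constant \<open>4\<close>, the
  value of \<open>2 / (1 - c)\<close> at \<open>c = 1 / 2\<close>.
\<close>

section \<open>The dual norm of a subspace\<close>

lemma dual_norm_quotient_upper:
  assumes "x \<in> E"
  shows "blinfun_apply z x / norm x \<le> dual_norm E z"
proof -
  have "blinfun_apply z u / norm u \<le> norm z" for u
    using norm_blinfun[of z u] by (cases "u = 0") (simp_all add: pos_divide_le_eq)
  then have "bdd_above ((\<lambda>u. blinfun_apply z u / norm u) ` E)"
    by (intro bdd_aboveI2)
  then show ?thesis
    unfolding dual_norm_def using assms by (intro cSUP_upper)
qed

lemma dual_norm_upper:
  assumes "x \<in> E"
  shows "blinfun_apply z x \<le> dual_norm E z * norm x"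
  using dual_norm_quotient_upper[OF assms, of z]
  by (cases "x = 0") (simp_all add: pos_divide_le_eq)

lemma dual_norm_leI:
  assumes "E \<noteq> {}" "\<And>x. x \<in> E \<Longrightarrow> blinfun_apply z x / norm x \<le> M"
  shows "dual_norm E z \<le> M"
  unfolding dual_norm_def using assms by (intro cSUP_least)

lemma dual_norm_nonneg:
  assumes "subspace E"
  shows "0 \<le> dual_norm E z"
  using dual_norm_quotient_upper[OF subspace_0[OF assms], of z] by simp

lemma dual_norm_abs_upper:
  assumes "subspace E" "x \<in> E"
  shows "\<bar>blinfun_apply z x\<bar> \<le> dual_norm E z * norm x"
  using dual_norm_upper[OF assms(2), of z] dual_norm_upper[OF subspace_neg[OF assms], of z]
  by (simp add: blinfun.minus_right)

section \<open>Restriction to lines: tangents and the descent lemma\<close>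

text \<open>
  A derivative within \<open>E\<close> only controls \<open>f\<close> along directions in \<open>E\<close>. Since \<open>E\<close> contains the
  whole line, restricting to it yields an ordinary real derivative, to which the
  one-variable theorems apply.
\<close>

lemma has_field_derivative_along_line:
  assumes "subspace E" "x \<in> E" "d \<in> E"
    and "(f has_derivative f') (at (x + s *\<^sub>R d) within E)"
  shows "((\<lambda>s. f (x + s *\<^sub>R d)) has_field_derivative f' d) (at s)"
proof -
  have sub: "range (\<lambda>s. x + s *\<^sub>R d) \<subseteq> E"
    using assms(1-3) by (auto intro: subspace_add subspace_scale)
  have "((\<lambda>s. x + s *\<^sub>R d) has_derivative (\<lambda>h. h *\<^sub>R d)) (at s within UNIV)"
    by (auto intro!: derivative_eq_intros)
  from has_derivative_in_compose[OF this has_derivative_subset[OF assms(4) sub]]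
  have "((\<lambda>s. f (x + s *\<^sub>R d)) has_derivative (\<lambda>h. f' (h *\<^sub>R d))) (at s)"
    by simp
  moreover have "f' (h *\<^sub>R d) = f' d * h" for h
    using linear_scale[OF has_derivative_linear[OF assms(4)], of h d] by simp
  ultimately show ?thesis
    by (simp add: has_field_derivative_def)
qed

lemma convex_on_above_tangent:
  assumes "subspace E" "x \<in> E" "y \<in> E" "convex_on E f"
    and "(f has_derivative f') (at x within E)"
  shows "f x + f' (y - x) \<le> f y"
proof -
  define d where "d = y - x"
  have d: "d \<in> E" unfolding d_def using assms(1-3) by (intro subspace_diff)
  have "convex_on UNIV (\<lambda>s. f (x + s *\<^sub>R d))"
  proof (rule convex_onI)
    fix t a b :: real assume t: "0 < t" "t < 1"
    have "x + ((1 - t) *\<^sub>R a + t *\<^sub>R b) *\<^sub>R d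
        = (1 - t) *\<^sub>R (x + a *\<^sub>R d) + t *\<^sub>R (x + b *\<^sub>R d)"
      by (simp add: algebra_simps)
    then show "f (x + ((1 - t) *\<^sub>R a + t *\<^sub>R b) *\<^sub>R d)
        \<le> (1 - t) * f (x + a *\<^sub>R d) + t * f (x + b *\<^sub>R d)"
      using convex_onD[OF assms(4), of t "x + a *\<^sub>R d" "x + b *\<^sub>R d"] t assms(1,2) d
      by (auto intro: subspace_add subspace_scale)
  qed simp
  moreover have "((\<lambda>s. f (x + s *\<^sub>R d)) has_field_derivative f' d) (at 0)"
    using has_field_derivative_along_line[OF assms(1,2) d, of f f' 0] assms(5) by simp
  ultimately have "f (x + 1 *\<^sub>R d) - f (x + 0 *\<^sub>R d) \<ge> f' d * (1 - 0)"
    by (intro convex_on_imp_above_tangent[where A = UNIV]) auto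
  then show ?thesis by (simp add: d_def)
qed

text \<open>
  Both signs are used: the upper bound for the gradient step from \<open>x\<^sub>k\<close> to \<open>y\<^sub>k\<close>, the lower bound as
  the substitute for convexity in the momentum step. Both say that a function on the line
  from \<open>x\<close> to \<open>y\<close> has nonpositive derivative.
\<close>

lemma L_smooth_quadratic_bound:
  assumes E: "subspace E" and sm: "L_smooth_on L f g E" and x: "x \<in> E" and y: "y \<in> E"
  shows "\<bar>f y - f x - blinfun_apply (g x) (y - x)\<bar> \<le> L / 2 * (norm (y - x))\<^sup>2"
proof -
  define d where "d = y - x"
  have d: "d \<in> E" unfolding d_def using E x y by (intro subspace_diff)
  have p: "x + s *\<^sub>R d \<in> E" for s
    using E x d by (intro subspace_add subspace_scale)
  have "(f has_derivative blinfun_apply (g (x + s *\<^sub>R d))) (at (x + s *\<^sub>R d) within E)" for s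
    using sm p unfolding L_smooth_on_def C1_on_def has_gradient_on_def by blast
  note D = has_field_derivative_along_line[OF E x d this]
  \<comment> \<open>\<open>\<sigma> = 1\<close> gives the upper and \<open>\<sigma> = - 1\<close> the lower bound\<close>
  have bound: "\<sigma> * (f y - f x - blinfun_apply (g x) (y - x)) \<le> L / 2 * (norm (y - x))\<^sup>2"
    if \<sigma>: "\<bar>\<sigma>\<bar> = 1" for \<sigma> :: real
  proof -
    define \<phi> where "\<phi> s = \<sigma> * (f (x + s *\<^sub>R d) - s * blinfun_apply (g x) d)
        - L / 2 * (norm d)\<^sup>2 * s\<^sup>2" for s
    have D\<phi>: "(\<phi> has_field_derivative
        \<sigma> * (blinfun_apply (g (x + s *\<^sub>R d)) d - blinfun_apply (g x) d) - L * (norm d)\<^sup>2 * s) (at s)"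
      for s
      unfolding \<phi>_def by (rule derivative_eq_intros D | simp)+
    have le: "\<sigma> * (blinfun_apply (g (x + s *\<^sub>R d)) d - blinfun_apply (g x) d)
        - L * (norm d)\<^sup>2 * s \<le> 0" if "0 \<le> s" for s
    proof -
      have "\<sigma> * blinfun_apply (g (x + s *\<^sub>R d) - g x) d
          \<le> \<bar>blinfun_apply (g (x + s *\<^sub>R d) - g x) d\<bar>"
        using \<sigma> abs_ge_self[of "\<sigma> * blinfun_apply (g (x + s *\<^sub>R d) - g x) d"]
        by (simp add: abs_mult)
      also have "\<dots> \<le> dual_norm E (g (x + s *\<^sub>R d) - g x) * norm d"
        using E d by (rule dual_norm_abs_upper)
      also have "dual_norm E (g (x + s *\<^sub>R d) - g x) \<le> L * norm (x + s *\<^sub>R d - x)"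
        using sm p x unfolding L_smooth_on_def by blast
      finally have "\<sigma> * blinfun_apply (g (x + s *\<^sub>R d) - g x) d
          \<le> (L * norm (x + s *\<^sub>R d - x)) * norm d"
        by (simp add: mult_right_mono)
      then show ?thesis
        using that by (simp add: blinfun.diff_left power2_eq_square algebra_simps)
    qed
    have "\<phi> 1 \<le> \<phi> 0"
    proof (rule DERIV_nonpos_imp_nonincreasing[where f = \<phi>])
      fix s :: real assume "0 \<le> s"
      then show "\<exists>l. DERIV \<phi> s :> l \<and> l \<le> 0"
        using D\<phi>[of s] le[of s] by blast
    qed simp
    then show ?thesis by (simp add: \<phi>_def d_def algebra_simps)
  qed
  show ?thesis unfolding abs_le_iff using bound[of 1] bound[of "- 1"] by simp
qed

text \<open>
  Minimizing the model along the line through \<open>x\<close> in a single direction \<open>d\<close> already gives the value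
  \<open>- (\<langle>g, d\<rangle> / \<parallel>d\<parallel>)\<^sup>2 / (2 L)\<close>; the supremum over \<open>d\<close> is the dual norm. Thus no maximizing direction
  has to be exhibited.
\<close>

lemma quadratic_model_min_le:
  assumes E: "subspace E" and x: "x \<in> E" and L: "L > 0"
    and y: "is_arg_min (\<lambda>u. blinfun_apply g (u - x) + L / 2 * (norm (u - x))\<^sup>2) (\<lambda>u. u \<in> E) y"
  shows "blinfun_apply g (y - x) + L / 2 * (norm (y - x))\<^sup>2 \<le> - (dual_norm E g)\<^sup>2 / (2 * L)"
proof -
  define m where "m = blinfun_apply g (y - x) + L / 2 * (norm (y - x))\<^sup>2"
  have min: "m \<le> blinfun_apply g (u - x) + L / 2 * (norm (u - x))\<^sup>2" if "u \<in> E" for u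
    using y that unfolding is_arg_min_linorder m_def by blast
  have m0: "m \<le> 0" using min[OF x] by simp
  have "dual_norm E g \<le> sqrt (- (2 * L * m))"
  proof (rule dual_norm_leI)
    show "E \<noteq> {}" using x by blast
    fix d assume d: "d \<in> E"
    show "blinfun_apply g d / norm d \<le> sqrt (- (2 * L * m))"
    proof (cases "d = 0")
      case True
      then show ?thesis using m0 L by (simp add: mult_nonneg_nonpos)
    next
      case False
      define r where "r = blinfun_apply g d"
      define n where "n = norm d"
      have n: "n > 0" using False by (simp add: n_def)
      \<comment> \<open>the minimizer of the model on the line through \<open>x\<close> in direction \<open>d\<close>\<close>
      define s where "s = - r / (L * n\<^sup>2)"
      have "x + s *\<^sub>R d \<in> E" using E x d by (intro subspace_add subspace_scale)
      from min[OF this] have "m \<le> s * r + L / 2 * (s\<^sup>2 * n\<^sup>2)"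
        by (simp add: blinfun.scaleR_right r_def n_def power_mult_distrib)
      also have "\<dots> = - (r / n)\<^sup>2 / (2 * L)"
        using L n by (simp add: s_def field_simps power2_eq_square)
      finally have "(r / n)\<^sup>2 / (2 * L) \<le> - m"
        by simp
      then have "(r / n)\<^sup>2 \<le> - (2 * L * m)"
        using L by (simp add: pos_divide_le_eq mult.commute)
      then show ?thesis unfolding r_def n_def by (rule real_le_rsqrt)
    qed
  qed
  then have "(dual_norm E g)\<^sup>2 \<le> (sqrt (- (2 * L * m)))\<^sup>2"
    using dual_norm_nonneg[OF E] by (intro power_mono)
  also have "\<dots> = - (2 * L * m)"
    using m0 L by (simp add: mult_nonneg_nonpos)
  finally have "(dual_norm E g)\<^sup>2 / (2 * L) \<le> - m"
    using L by (simp add: pos_divide_le_eq mult_ac)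
  then show ?thesis by (simp add: m_def)
qed

section \<open>The conjugate of a strongly convex function\<close>

lemma Young_quadratic:
  fixes a b \<mu> :: real
  assumes "\<mu> > 0"
  shows "a * b - \<mu> / 2 * b\<^sup>2 \<le> a\<^sup>2 / (2 * \<mu>)"
proof -
  have "0 \<le> (a - \<mu> * b)\<^sup>2 / (2 * \<mu>)" using assms by simp
  also have "\<dots> = a\<^sup>2 / (2 * \<mu>) - (a * b - \<mu> / 2 * b\<^sup>2)"
    using assms by (simp add: field_simps power2_eq_square)
  finally show ?thesis by simp
qed

locale mirror_map =
  fixes E :: "'a::real_normed_vector set" and \<psi> g\<psi> \<mu> D
  assumes subspace: "subspace E"
    and mu_pos: "\<mu> > 0"
    and strongly_convex: "strongly_convex_C1_on \<mu> \<psi> g\<psi> E"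
    and conjugate_gradient: "conjugate_gradient E \<psi> D"
begin

lemma D_in: "D z \<in> E"
  using conjugate_gradient unfolding conjugate_gradient_def by blast

lemma strong_convexity:
  assumes "x \<in> E" "y \<in> E"
  shows "\<psi> x + blinfun_apply (g\<psi> x) (y - x) + \<mu> / 2 * (norm (y - x))\<^sup>2 \<le> \<psi> y"
  using strongly_convex assms unfolding strongly_convex_C1_on_def by blast

lemma Jensen:
  assumes u: "u \<in> E" and v: "v \<in> E" and t: "0 \<le> t" "t \<le> 1"
  shows "\<psi> ((1 - t) *\<^sub>R u + t *\<^sub>R v) \<le> (1 - t) * \<psi> u + t * \<psi> v"
proof -
  define m where "m = (1 - t) *\<^sub>R u + t *\<^sub>R v"
  have m: "m \<in> E" unfolding m_def using subspace u v by (intro subspace_add subspace_scale)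
  have above: "\<psi> m + blinfun_apply (g\<psi> m) (y - m) \<le> \<psi> y" if "y \<in> E" for y
  proof -
    have "0 \<le> \<mu> / 2 * (norm (y - m))\<^sup>2" using mu_pos by simp
    with strong_convexity[OF m that] show ?thesis by linarith
  qed
  have "(1 - t) *\<^sub>R (u - m) + t *\<^sub>R (v - m) = 0"
    by (simp add: m_def algebra_simps)
  then have "blinfun_apply (g\<psi> m) ((1 - t) *\<^sub>R (u - m) + t *\<^sub>R (v - m)) = 0"
    by simp
  then have "(1 - t) * blinfun_apply (g\<psi> m) (u - m) + t * blinfun_apply (g\<psi> m) (v - m) = 0"
    by (simp add: blinfun.add_right blinfun.scaleR_right)
  moreover have "(1 - t) * (\<psi> m + blinfun_apply (g\<psi> m) (u - m)) \<le> (1 - t) * \<psi> u"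
    "t * (\<psi> m + blinfun_apply (g\<psi> m) (v - m)) \<le> t * \<psi> v"
    using above u v t by (auto intro: mult_left_mono)
  ultimately show ?thesis unfolding m_def[symmetric] by (simp add: algebra_simps)
qed

text \<open>
  Quadratic growth of \<open>\<psi>\<close> makes the supremum that defines the conjugate a genuine one, so that the
  Fenchel-Young inequality is available.
\<close>

lemma conjugate_bdd: "bdd_above ((\<lambda>x. blinfun_apply z x - \<psi> x) ` E)"
proof (rule bdd_aboveI2)
  fix x assume x: "x \<in> E"
  have "blinfun_apply (z - g\<psi> 0) x \<le> norm (z - g\<psi> 0) * norm x"
    using norm_blinfun[of "z - g\<psi> 0" x] by simp
  moreover have "\<psi> 0 + blinfun_apply (g\<psi> 0) x + \<mu> / 2 * (norm x)\<^sup>2 \<le> \<psi> x"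
    using strong_convexity[OF subspace_0[OF subspace] x] by simp
  ultimately show "blinfun_apply z x - \<psi> x \<le> (norm (z - g\<psi> 0))\<^sup>2 / (2 * \<mu>) - \<psi> 0"
    using Young_quadratic[OF mu_pos, of "norm (z - g\<psi> 0)" "norm x"]
    by (simp add: blinfun.diff_left)
qed

lemma Fenchel_Young:
  assumes "x \<in> E"
  shows "blinfun_apply z x - \<psi> x \<le> conjugate E \<psi> z"
  unfolding conjugate_def using conjugate_bdd assms by (rule cSUP_upper2) simp_all

lemma conjugate_leI:
  assumes "\<And>x. x \<in> E \<Longrightarrow> blinfun_apply z x - \<psi> x \<le> M"
  shows "conjugate E \<psi> z \<le> M"
  unfolding conjugate_def using subspace_0[OF subspace] assms by (intro cSUP_least) auto

lemma conjugate_convex: "convex_on UNIV (conjugate E \<psi>)"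
proof (rule convex_onI)
  fix t :: real and p q :: "'a \<Rightarrow>\<^sub>L real"
  assume t: "0 < t" "t < 1"
  show "conjugate E \<psi> ((1 - t) *\<^sub>R p + t *\<^sub>R q)
      \<le> (1 - t) * conjugate E \<psi> p + t * conjugate E \<psi> q"
  proof (rule conjugate_leI)
    fix x assume x: "x \<in> E"
    have "blinfun_apply ((1 - t) *\<^sub>R p + t *\<^sub>R q) x - \<psi> x
        = (1 - t) * (blinfun_apply p x - \<psi> x) + t * (blinfun_apply q x - \<psi> x)"
      unfolding blinfun.add_left blinfun.scaleR_left by (simp add: algebra_simps)
    also have "\<dots> \<le> (1 - t) * conjugate E \<psi> p + t * conjugate E \<psi> q"
      using Fenchel_Young[OF x] t by (intro add_mono mult_left_mono) auto
    finally show "blinfun_apply ((1 - t) *\<^sub>R p + t *\<^sub>R q) x - \<psi> x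
        \<le> (1 - t) * conjugate E \<psi> p + t * conjugate E \<psi> q" .
  qed
qed simp

text \<open>
  The gradient of the conjugate is the maximizer. The tangent to the conjugate at \<open>z\<close> is evaluation at
  \<open>p = D z\<close>, up to a constant. Compare it with the conjugate at the functional \<open>\<nabla>\<psi> p\<close>, where the supremum is
  attained at \<open>p\<close> itself by convexity of \<open>\<psi>\<close>: this gives \<open>\<psi>\<^sup>* z - \<langle>z, p\<rangle> \<le> - \<psi> p\<close>. Existence of a
  maximizer thus follows without compactness, and its identification with \<open>D z\<close> without extending
  functionals from \<open>E\<close>.
\<close>

lemma conjugate_attained: "conjugate E \<psi> z = blinfun_apply z (D z) - \<psi> (D z)"
proof (rule antisym)
  let ?p = "D z"
  have "conjugate E \<psi> (g\<psi> ?p) \<le> blinfun_apply (g\<psi> ?p) ?p - \<psi> ?p"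
  proof (rule conjugate_leI)
    fix x assume x: "x \<in> E"
    have "0 \<le> \<mu> / 2 * (norm (x - ?p))\<^sup>2" using mu_pos by simp
    with strong_convexity[OF D_in x, of z]
    show "blinfun_apply (g\<psi> ?p) x - \<psi> x \<le> blinfun_apply (g\<psi> ?p) ?p - \<psi> ?p"
      by (simp add: blinfun.diff_right)
  qed
  moreover have "conjugate E \<psi> z + blinfun_apply (g\<psi> ?p - z) ?p \<le> conjugate E \<psi> (g\<psi> ?p)"
  proof (rule convex_on_above_tangent[OF subspace_UNIV, where f' = "\<lambda>w. blinfun_apply w ?p"])
    show "(conjugate E \<psi> has_derivative (\<lambda>w. blinfun_apply w ?p)) (at z)"
      using conjugate_gradient unfolding conjugate_gradient_def by blast
  qed (use conjugate_convex in auto)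
  ultimately show "conjugate E \<psi> z \<le> blinfun_apply z ?p - \<psi> ?p"
    by (simp add: blinfun.diff_left)
qed (rule Fenchel_Young[OF D_in])

text \<open>First-order optimality of the maximizer: \<open>\<nabla>\<psi>\<close> inverts \<open>\<nabla>\<psi>\<^sup>*\<close> on \<open>E\<close>.\<close>

lemma gradient_at_D:
  assumes d: "d \<in> E"
  shows "blinfun_apply (g\<psi> (D z)) d = blinfun_apply z d"
proof -
  define \<phi> where "\<phi> s = \<psi> (D z + s *\<^sub>R d) - blinfun_apply z (D z + s *\<^sub>R d)" for s
  have "(\<psi> has_derivative blinfun_apply (g\<psi> (D z + 0 *\<^sub>R d))) (at (D z + 0 *\<^sub>R d) within E)"
    using strongly_convex D_in[of z]
    unfolding strongly_convex_C1_on_def C1_on_def has_gradient_on_def by simp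
  note D = has_field_derivative_along_line[OF subspace D_in d this]
  have "(\<phi> has_field_derivative blinfun_apply (g\<psi> (D z)) d - blinfun_apply z d) (at 0)"
    unfolding \<phi>_def blinfun.add_right blinfun.scaleR_right
    by (rule derivative_eq_intros D | simp)+
  moreover have "\<phi> 0 \<le> \<phi> s" for s
  proof -
    have "D z + s *\<^sub>R d \<in> E" using subspace D_in d by (intro subspace_add subspace_scale)
    from Fenchel_Young[OF this, of z] show ?thesis
      by (simp add: conjugate_attained \<phi>_def)
  qed
  ultimately have "blinfun_apply (g\<psi> (D z)) d - blinfun_apply z d = 0"
    by (intro DERIV_local_min[of \<phi> _ 0 1]) auto
  then show ?thesis by simp
qed

text \<open>
  Strong convexity of \<open>\<psi>\<close> is smoothness of \<open>\<psi>\<^sup>*\<close>: the objective defining \<open>\<psi>\<^sup>* (z + h)\<close> decays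
  quadratically away from \<open>D z\<close>, and Young's inequality weighs this against the linear gain from \<open>h\<close>.
  The bound \<open>M\<close> stands for the dual norm of \<open>h\<close> on \<open>E\<close>.
\<close>

lemma conjugate_smooth:
  assumes h: "\<And>d. d \<in> E \<Longrightarrow> blinfun_apply h d \<le> M * norm d"
  shows "conjugate E \<psi> (z + h) \<le> conjugate E \<psi> z + blinfun_apply h (D z) + M\<^sup>2 / (2 * \<mu>)"
proof (rule conjugate_leI)
  fix x assume x: "x \<in> E"
  define d where "d = x - D z"
  have d: "d \<in> E" unfolding d_def using subspace x D_in by (rule subspace_diff)
  have xd: "x = D z + d" by (simp add: d_def)
  have "\<psi> (D z) + blinfun_apply z d + \<mu> / 2 * (norm d)\<^sup>2 \<le> \<psi> x"
    using strong_convexity[OF D_in x, of z] gradient_at_D[OF d] by (simp add: d_def)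
  then show "blinfun_apply (z + h) x - \<psi> x
      \<le> conjugate E \<psi> z + blinfun_apply h (D z) + M\<^sup>2 / (2 * \<mu>)"
    using h[OF d] Young_quadratic[OF mu_pos, of M "norm d"]
    by (simp add: conjugate_attained blinfun.add_left xd blinfun.add_right)
qed

section \<open>The Fenchel gap as momentum energy\<close>

text \<open>
  This is the Bregman divergence of \<open>\<psi>\<close> between \<open>w\<close> and \<open>D z\<close>, in a form that is affine in \<open>z\<close>
  apart from \<open>\<psi>\<^sup>*\<close>.
\<close>

definition gap :: "'a \<Rightarrow> ('a \<Rightarrow>\<^sub>L real) \<Rightarrow> real" where
  "gap w z = \<psi> w + conjugate E \<psi> z - blinfun_apply z w"

lemma gap_D: "gap (D z) z = 0"
  by (simp add: gap_def conjugate_attained)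

lemma gap_ge_quadratic:
  assumes w: "w \<in> E"
  shows "\<mu> / 2 * (norm (w - D z))\<^sup>2 \<le> gap w z"
proof -
  have "w - D z \<in> E" using subspace w D_in by (rule subspace_diff)
  from gradient_at_D[OF this] strong_convexity[OF D_in w, of z] show ?thesis
    by (simp add: gap_def conjugate_attained blinfun.diff_right)
qed

lemma gap_nonneg:
  assumes "w \<in> E"
  shows "0 \<le> gap w z"
proof -
  have "0 \<le> \<mu> / 2 * (norm (w - D z))\<^sup>2"
    using mu_pos by simp
  also have "\<dots> \<le> gap w z"
    using assms by (rule gap_ge_quadratic)
  finally show ?thesis .
qed

lemma gap_averaging:
  assumes w: "w \<in> E" and t: "0 \<le> t" "t \<le> 1"
  shows "gap ((1 - t) *\<^sub>R w + t *\<^sub>R D z) z \<le> (1 - t) * gap w z"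
  using Jensen[OF w D_in t, of z]
  unfolding gap_def conjugate_attained blinfun.add_right blinfun.scaleR_right
  by (simp add: left_diff_distrib right_diff_distrib distrib_left)

lemma gap_dual_step:
  assumes w: "w \<in> E" and h: "\<And>d. d \<in> E \<Longrightarrow> blinfun_apply h d \<le> M * norm d"
  shows "gap w (z + h) \<le> gap w z + blinfun_apply h (D z - w) + M\<^sup>2 / (2 * \<mu>)"
  using conjugate_smooth[OF h, of z]
  by (simp add: gap_def blinfun.add_left blinfun.diff_right)

text \<open>
  One step of the method, for arbitrary weights. The error \<open>e\<close> records by how much \<open>f\<close> may fail to
  lie above its tangent at \<open>x\<close>.
\<close>

lemma momentum_step:
  assumes L: "L > 0" and H: "H > 0" and t: "0 < t" "t < 1"
    and sm: "L_smooth_on L f g E"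
    and y: "y \<in> E" and w: "w \<in> E"
    and x: "x = y + t *\<^sub>R (D z - w)"
    and z': "z' = z - (t * H) *\<^sub>R g x"
    and w': "w' = (1 - t) *\<^sub>R w + t *\<^sub>R D z'"
    and y': "is_arg_min (\<lambda>u. blinfun_apply (g x) (u - x) + L / 2 * (norm (u - x))\<^sup>2) (\<lambda>u. u \<in> E) y'"
    and lower: "f x + blinfun_apply (g x) (y - x) \<le> f y + e"
  shows "f y' + (1 / (2 * L) - t\<^sup>2 * H / (2 * \<mu>)) * (dual_norm E (g x))\<^sup>2
    \<le> f y + e + (gap w z - gap w' z' / (1 - t)) / H"
proof -
  define N where "N = dual_norm E (g x)"
  have v: "D z \<in> E" by (rule D_in)
  have xE: "x \<in> E" unfolding x using subspace y w v by (intro subspace_add subspace_scale subspace_diff)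
  have y'E: "y' \<in> E" using y' by (simp add: is_arg_min_def)
  have f1: "f y' \<le> f x - N\<^sup>2 / (2 * L)"
    using L_smooth_quadratic_bound[OF subspace sm xE y'E] quadratic_model_min_le[OF subspace xE L y']
    unfolding N_def by linarith
  have f2: "f x \<le> f y + e + t * blinfun_apply (g x) (D z - w)"
    using lower by (simp add: x blinfun.add_right blinfun.diff_right blinfun.scaleR_right algebra_simps)
  have "gap w (z + (- (t * H)) *\<^sub>R g x) \<le> gap w z
      + blinfun_apply ((- (t * H)) *\<^sub>R g x) (D z - w) + (t * H * N)\<^sup>2 / (2 * \<mu>)"
  proof (rule gap_dual_step[OF w])
    fix d assume "d \<in> E"
    then have "\<bar>blinfun_apply (g x) d\<bar> \<le> N * norm d"
      unfolding N_def by (rule dual_norm_abs_upper[OF subspace])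
    then have "t * H * (- blinfun_apply (g x) d) \<le> t * H * (N * norm d)"
      using t H by (intro mult_left_mono) auto
    then show "blinfun_apply ((- (t * H)) *\<^sub>R g x) d \<le> t * H * N * norm d"
      by (simp add: blinfun.scaleR_left blinfun.minus_left algebra_simps)
  qed
  then have "gap w z' \<le> gap w z - t * H * blinfun_apply (g x) (D z - w) + t\<^sup>2 * H\<^sup>2 * N\<^sup>2 / (2 * \<mu>)"
    by (simp add: z' blinfun.scaleR_left blinfun.minus_left power_mult_distrib)
  moreover have "gap w' z' / (1 - t) \<le> gap w z'"
    using gap_averaging[OF w, of t z'] t unfolding w' by (simp add: pos_divide_le_eq mult.commute)
  ultimately have "H * (t * blinfun_apply (g x) (D z - w))
      \<le> gap w z - gap w' z' / (1 - t) + H * (t\<^sup>2 * H * N\<^sup>2 / (2 * \<mu>))"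
    by (simp add: power2_eq_square algebra_simps)
  then have "t * blinfun_apply (g x) (D z - w)
      \<le> (gap w z - gap w' z' / (1 - t) + H * (t\<^sup>2 * H * N\<^sup>2 / (2 * \<mu>))) / H"
    using H by (simp add: pos_le_divide_eq mult.commute)
  also have "\<dots> = (gap w z - gap w' z' / (1 - t)) / H + t\<^sup>2 * H * N\<^sup>2 / (2 * \<mu>)"
    using H by (simp add: add_divide_distrib)
  finally show ?thesis
    using f1 f2 unfolding N_def[symmetric] by (simp add: left_diff_distrib)
qed

end

section \<open>Telescoping the energy estimate\<close>

text \<open>
  The weights are shifted: the energy \<open>G\<^sub>k\<close> is released with weight \<open>\<beta>\<^sub>k\<close> by step \<open>k\<close> and charged with
  weight \<open>\<alpha>\<^sub>k\<^sub>+\<^sub>1\<close> by the next one. As \<open>G\<close> starts at \<open>0\<close>, the first step is charged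
  nothing.
\<close>

lemma telescoping_energy_bound:
  fixes F G N \<alpha> \<beta> :: "nat \<Rightarrow> real"
  assumes step: "\<And>k. F (Suc k) + \<delta> * N (Suc k) \<le> F k + \<alpha> (Suc k) * G k - \<beta> (Suc k) * G (Suc k)"
    and weights: "\<And>k. \<alpha> (Suc (Suc k)) \<le> \<beta> (Suc k)"
    and G: "\<And>k. 0 \<le> G k" "G 0 = 0"
  shows "F k + \<delta> * (\<Sum>i=1..k. N i) + \<alpha> (Suc k) * G k \<le> F 0"
proof (induction k)
  case 0
  then show ?case using G by simp
next
  case (Suc k)
  have "\<alpha> (Suc (Suc k)) * G (Suc k) \<le> \<beta> (Suc k) * G (Suc k)"
    using weights G by (intro mult_right_mono)
  with Suc step[of k] show ?case by (simp add: distrib_left)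
qed

lemma Min_mult_card_le_sum:
  fixes N :: "nat \<Rightarrow> real"
  shows "real k * (MIN i\<in>{1..k}. N i) \<le> (\<Sum>i=1..k. N i)"
proof -
  have "of_nat (card {1..k}) * (MIN i\<in>{1..k}. N i) \<le> (\<Sum>i=1..k. N i)"
    by (intro sum_bounded_below Min_le) auto
  then show ?thesis by simp
qed

section \<open>The accelerated method\<close>

locale momentum_method = mirror_map E \<psi> g\<psi> \<mu> D
  for E :: "'a::real_normed_vector set" and \<psi> g\<psi> \<mu> D +
  fixes f g L xstar and a A H :: "nat \<Rightarrow> real" and c x y z
  assumes L_pos: "L > 0"
    and smooth: "L_smooth_on L f g E"
    and minimizer: "is_arg_min f (\<lambda>u. u \<in> E) xstar"
    and a_pos: "\<And>i. a i > 0"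
    and A_eq: "\<And>k. A k = (\<Sum>i\<le>k. a i)"
    and c: "0 < c" "c < 1"
    and H_pos: "\<And>i. i \<ge> 1 \<Longrightarrow> H i > 0"
    and coupling: "\<And>i. i \<ge> 1 \<Longrightarrow> (a i)\<^sup>2 / (A i)\<^sup>2 = c * (\<mu> / (L * H i))"
    and iterates: "momentum_iterates E g L D a A H x y z"
begin

text \<open>The parameters of \<open>momentum_step\<close> along the iteration.\<close>

definition t :: "nat \<Rightarrow> real" where "t k = a k / A k"

definition w :: "nat \<Rightarrow> 'a" where "w k = (1 / A k) *\<^sub>R (\<Sum>i\<le>k. a i *\<^sub>R D (z i))"

definition energy :: "nat \<Rightarrow> real" where "energy k = gap (w k) (z k)"

lemma A_pos: "A k > 0"
  unfolding A_eq using a_pos by (intro sum_pos) auto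

lemma A_Suc: "A (Suc k) = A k + a (Suc k)"
  by (simp add: A_eq)

lemma t_bounds: "0 < t (Suc k)" "t (Suc k) < 1"
  using a_pos[of "Suc k"] A_pos[of k] by (simp_all add: t_def A_Suc)

lemma t_square: "(t (Suc k))\<^sup>2 = c * \<mu> / (L * H (Suc k))"
  using coupling[of "Suc k"] by (simp add: t_def power_divide)

lemma w_0: "w 0 = D (z 0)"
  using a_pos[of 0] by (simp add: w_def A_eq)

lemma w_Suc: "w (Suc k) = (1 - t (Suc k)) *\<^sub>R w k + t (Suc k) *\<^sub>R D (z (Suc k))"
proof -
  have "1 - t (Suc k) = A k / A (Suc k)"
    using A_pos[of "Suc k"] by (simp add: t_def field_simps A_Suc)
  then show ?thesis
    using A_pos[of k] by (simp add: w_def t_def scaleR_add_right)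
qed

lemma w_in: "w k \<in> E"
  unfolding w_def using subspace D_in by (intro subspace_scale subspace_sum) auto

text \<open>
  The sum in the recursion runs up to \<open>k\<close>, so it is \<open>A\<^sub>k w\<^sub>k\<close> and its coefficient
  cancels the factor \<open>A\<^sub>k\<close>.
\<close>

lemma x_Suc: "x (Suc k) = y k + t (Suc k) *\<^sub>R (D (z k) - w k)"
proof -
  have "x (Suc k) = y k + t (Suc k) *\<^sub>R D (z k)
      - (a (Suc k) / (A (Suc k) * A k)) *\<^sub>R (\<Sum>i<Suc k. a i *\<^sub>R D (z i))"
    using iterates unfolding momentum_iterates_def t_def by auto
  then show ?thesis
    by (simp add: w_def t_def lessThan_Suc_atMost scaleR_diff_right)
qed

lemma z_Suc: "z (Suc k) = z k - (t (Suc k) * H (Suc k)) *\<^sub>R g (x (Suc k))"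
  using iterates unfolding momentum_iterates_def t_def by auto

lemma y_Suc: "is_arg_min (\<lambda>u. blinfun_apply (g (x (Suc k))) (u - x (Suc k))
    + L / 2 * (norm (u - x (Suc k)))\<^sup>2) (\<lambda>u. u \<in> E) (y (Suc k))"
proof -
  have "\<forall>k\<ge>1. is_arg_min (\<lambda>u. blinfun_apply (g (x k)) (u - x k)
      + L / 2 * (norm (u - x k))\<^sup>2) (\<lambda>u. u \<in> E) (y k)"
    using iterates unfolding momentum_iterates_def by blast
  then have "1 \<le> Suc k \<longrightarrow> ?thesis"
    by (rule spec)
  then show ?thesis
    by (rule mp) simp
qed

lemma start: "x 0 = D (z 0)" "y 0 = D (z 0)"
  using iterates unfolding momentum_iterates_def by auto

lemma y_in: "y k \<in> E"
  using start(2) D_in y_Suc by (cases k) (auto simp: is_arg_min_def)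

lemma x_Suc_in: "x (Suc k) \<in> E"
  unfolding x_Suc using subspace y_in w_in D_in
  by (intro subspace_add subspace_scale subspace_diff)

lemma energy_nonneg: "0 \<le> energy k"
  unfolding energy_def using w_in by (rule gap_nonneg)

lemma energy_0: "energy 0 = 0"
  by (simp add: energy_def w_0 gap_D)

text \<open>
  The coupling of \<open>a\<close> and \<open>H\<close> enters here: it turns the coefficient \<open>t\<^sup>2 H / (2 \<mu>)\<close> into \<open>c / (2 L)\<close>.
\<close>

lemma energy_step:
  assumes "f (x (Suc k)) + blinfun_apply (g (x (Suc k))) (y k - x (Suc k)) \<le> f (y k) + e"
  shows "f (y (Suc k)) + (1 - c) / (2 * L) * (dual_norm E (g (x (Suc k))))\<^sup>2
    \<le> f (y k) + e + (energy k - energy (Suc k) / (1 - t (Suc k))) / H (Suc k)"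
proof -
  have "1 / (2 * L) - (t (Suc k))\<^sup>2 * H (Suc k) / (2 * \<mu>) = (1 - c) / (2 * L)"
    using L_pos mu_pos H_pos[of "Suc k"] by (simp add: t_square field_simps)
  then show ?thesis
    using momentum_step[OF L_pos H_pos t_bounds smooth y_in w_in x_Suc z_Suc w_Suc y_Suc assms]
    by (simp add: energy_def)
qed

lemma best_gradient_bound:
  assumes step: "\<And>k. f (y (Suc k)) + (1 - c) / (2 * L) * (dual_norm E (g (x (Suc k))))\<^sup>2
      \<le> f (y k) + \<alpha> (Suc k) * energy k - \<beta> (Suc k) * energy (Suc k)"
    and weights: "\<And>k. \<alpha> (Suc (Suc k)) \<le> \<beta> (Suc k)"
    and nonneg: "\<And>k. 0 \<le> \<alpha> (Suc k)"
    and k: "k \<ge> 1"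
  shows "(MIN i\<in>{1..k}. (dual_norm E (g (x i)))\<^sup>2) \<le> 2 * L * (f (x 0) - f xstar) / ((1 - c) * real k)"
proof -
  define M where "M = (MIN i\<in>{1..k}. (dual_norm E (g (x i)))\<^sup>2)"
  have "f (y k) + (1 - c) / (2 * L) * (\<Sum>i=1..k. (dual_norm E (g (x i)))\<^sup>2)
      + \<alpha> (Suc k) * energy k \<le> f (y 0)"
    using telescoping_energy_bound[of "\<lambda>k. f (y k)" "(1 - c) / (2 * L)"
        "\<lambda>k. (dual_norm E (g (x k)))\<^sup>2" \<alpha> energy \<beta> k]
      step weights energy_nonneg energy_0 by blast
  moreover have "0 \<le> \<alpha> (Suc k) * energy k"
    using nonneg energy_nonneg by (rule mult_nonneg_nonneg)
  moreover have "f xstar \<le> f (y k)"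
    using minimizer y_in unfolding is_arg_min_linorder by blast
  moreover have "(1 - c) / (2 * L) * (real k * M)
      \<le> (1 - c) / (2 * L) * (\<Sum>i=1..k. (dual_norm E (g (x i)))\<^sup>2)"
    unfolding M_def using c L_pos by (intro mult_left_mono Min_mult_card_le_sum) auto
  ultimately have "(1 - c) / (2 * L) * (real k * M) \<le> f (x 0) - f xstar"
    using start by simp
  then have "M * ((1 - c) * real k) \<le> 2 * L * (f (x 0) - f xstar)"
    using L_pos by (simp add: field_simps)
  then show ?thesis
    unfolding M_def[symmetric] using c k by (simp add: pos_le_divide_eq)
qed

text \<open>
  The defect from convexity, a multiple of \<open>\<parallel>D z - w\<parallel>\<^sup>2\<close>, is dominated by the energy, which raises its charged
  weight from \<open>L / \<mu>\<close> to \<open>(1 + c) L / \<mu>\<close>. The released weight \<open>(L / \<mu>) / (1 - t)\<close> with \<open>t = \<surd>c\<close> is still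
  larger.
\<close>

lemma nonconvex_bound:
  assumes H: "\<And>i. i \<ge> 1 \<Longrightarrow> \<mu> / (L * H i) = 1" and k: "k \<ge> 1"
  shows "(MIN i\<in>{1..k}. (dual_norm E (g (x i)))\<^sup>2) \<le> 2 * L * (f (x 0) - f xstar) / ((1 - c) * real k)"
proof -
  have H_eq: "1 / H (Suc k) = L / \<mu>" for k
    using H[of "Suc k"] L_pos H_pos[of "Suc k"] mu_pos by (simp add: field_simps)
  have t2: "(t (Suc k))\<^sup>2 = c" for k
    using coupling[of "Suc k"] H[of "Suc k"] by (simp add: t_def power_divide)
  show ?thesis
  proof (rule best_gradient_bound[OF _ _ _ k])
    fix k
    let ?x = "x (Suc k)" and ?t = "t (Suc k)"
    have "f ?x + blinfun_apply (g ?x) (y k - ?x) \<le> f (y k) + L / 2 * (norm (y k - ?x))\<^sup>2"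
      using L_smooth_quadratic_bound[OF subspace smooth x_Suc_in y_in, of k k] by linarith
    moreover have "norm (y k - ?x) = ?t * norm (w k - D (z k))"
      using t_bounds(1)[of k] by (simp add: x_Suc norm_minus_commute)
    ultimately have "f ?x + blinfun_apply (g ?x) (y k - ?x)
        \<le> f (y k) + L / 2 * (c * (norm (w k - D (z k)))\<^sup>2)"
      by (simp add: power_mult_distrib t2)
    also have "L / 2 * (c * (norm (w k - D (z k)))\<^sup>2)
        = L / \<mu> * c * (\<mu> / 2 * (norm (w k - D (z k)))\<^sup>2)"
      using mu_pos by simp
    also have "\<dots> \<le> L / \<mu> * c * energy k"
      unfolding energy_def using L_pos mu_pos c
      by (intro mult_left_mono gap_ge_quadratic w_in) auto
    finally have "f ?x + blinfun_apply (g ?x) (y k - ?x) \<le> f (y k) + L / \<mu> * c * energy k"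
      by simp
    from energy_step[OF this]
    have "f (y (Suc k)) + (1 - c) / (2 * L) * (dual_norm E (g ?x))\<^sup>2
        \<le> f (y k) + L / \<mu> * c * energy k
          + (1 / H (Suc k)) * (energy k - energy (Suc k) / (1 - ?t))"
      by simp
    then show "f (y (Suc k)) + (1 - c) / (2 * L) * (dual_norm E (g ?x))\<^sup>2
        \<le> f (y k) + L / \<mu> * (1 + c) * energy k - L / \<mu> / (1 - ?t) * energy (Suc k)"
      unfolding H_eq by (simp add: distrib_left distrib_right right_diff_distrib)
    have "c \<le> ?t"
      using t2[of k] t_bounds[of k] by (metis less_eq_real_def mult_left_le power2_eq_square)
    moreover have "0 \<le> c * ?t"
      using c t_bounds(1)[of k] by simp
    ultimately have "(1 + c) * (1 - ?t) \<le> 1"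
      by (simp add: algebra_simps)
    then have "1 + c \<le> 1 / (1 - ?t)"
      using t_bounds[of k] by (simp add: pos_le_divide_eq)
    then have "L / \<mu> * (1 + c) \<le> L / \<mu> * (1 / (1 - ?t))"
      using L_pos mu_pos by (intro mult_left_mono) auto
    then show "L / \<mu> * (1 + c) \<le> L / \<mu> / (1 - ?t)"
      by simp
    show "0 \<le> L / \<mu> * (1 + c)"
      using L_pos mu_pos c by simp
  qed
qed

lemma convex_bound:
  assumes conv: "convex_on E f"
    and H_mono: "\<And>i. i \<ge> 1 \<Longrightarrow> H i \<le> H (Suc i)" and k: "k \<ge> 1"
  shows "(MIN i\<in>{1..k}. (dual_norm E (g (x i)))\<^sup>2) \<le> 2 * L * (f (x 0) - f xstar) / ((1 - c) * real k)"
proof (rule best_gradient_bound[OF _ _ _ k])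
  fix k
  let ?x = "x (Suc k)" and ?t = "t (Suc k)"
  have "(f has_derivative blinfun_apply (g ?x)) (at ?x within E)"
    using smooth x_Suc_in unfolding L_smooth_on_def C1_on_def has_gradient_on_def by blast
  from convex_on_above_tangent[OF subspace x_Suc_in y_in conv this]
  have "f ?x + blinfun_apply (g ?x) (y k - ?x) \<le> f (y k) + 0"
    by simp
  from energy_step[OF this]
  show "f (y (Suc k)) + (1 - c) / (2 * L) * (dual_norm E (g ?x))\<^sup>2
      \<le> f (y k) + 1 / H (Suc k) * energy k - 1 / (1 - ?t) / H (Suc k) * energy (Suc k)"
    by (simp add: diff_divide_distrib)
  have "1 / H (Suc (Suc k)) \<le> 1 / H (Suc k)"
    using H_mono[of "Suc k"] H_pos[of "Suc k"] by (simp add: frac_le)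
  also have "\<dots> \<le> 1 / (1 - ?t) / H (Suc k)"
    using t_bounds[of k] H_pos[of "Suc k"] by (intro divide_right_mono) auto
  finally show "1 / H (Suc (Suc k)) \<le> 1 / (1 - ?t) / H (Suc k)" .
  show "0 \<le> 1 / H (Suc k)"
    using H_pos[of "Suc k"] by simp
qed

lemma H_mono_of_powr:
  assumes lam: "0 \<le> lam" and H: "\<And>i. i \<ge> 1 \<Longrightarrow> H i = A i powr lam" and i: "i \<ge> 1"
  shows "H i \<le> H (Suc i)"
  using H[of i] H[of "Suc i"] i A_pos[of i] a_pos[of "Suc i"] lam
  by (auto simp: A_Suc intro!: powr_mono2)

text \<open>
  The constant must serve two forms of the rate. The first only loses a factor \<open>1 / c \<ge> 1\<close>; the
  second is the sharp bound at \<open>c = 1 / 2\<close>, where \<open>2 / (1 - c) = 4\<close>.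
\<close>

lemma rate_forms:
  assumes k: "k \<ge> 1" and B: "B \<le> 2 * L * (f (x 0) - f xstar) / ((1 - c) * real k)"
  shows "B \<le> 4 * (L * (f (x 0) - f xstar) / (c * (1 - c) * real k))"
    and "c = 1 / 2 \<Longrightarrow> B \<le> 4 * (L * (f (x 0) - f xstar) / real k)"
proof -
  define R where "R = L * (f (x 0) - f xstar) / ((1 - c) * real k)"
  have B2: "B \<le> 2 * R"
    using B by (simp add: R_def)
  have "f xstar \<le> f (x 0)"
    using minimizer D_in start unfolding is_arg_min_linorder by auto
  then have R: "0 \<le> R"
    unfolding R_def using L_pos c by (intro divide_nonneg_nonneg mult_nonneg_nonneg) auto
  have "R \<le> R / c"
    using R c by (simp add: pos_le_divide_eq mult_left_le)
  then have "2 * R \<le> 4 * (R / c)"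
    using R by linarith
  then have "B \<le> 4 * (R / c)"
    using B2 by linarith
  then show "B \<le> 4 * (L * (f (x 0) - f xstar) / (c * (1 - c) * real k))"
    by (simp add: R_def mult_ac)
  show "B \<le> 4 * (L * (f (x 0) - f xstar) / real k)" if "c = 1 / 2"
    using B2 that by (simp add: R_def)
qed

end

theorem corollary4p11:
  shows "\<exists>C>0. \<forall>(E :: 'a::real_normed_vector set) (f :: 'a \<Rightarrow> real) gf L xstar \<psi> g\<psi> \<mu> D
            (a :: nat \<Rightarrow> real) A H c x y z.
    finite_dim_subspace E \<and>
    L > 0 \<and> L_smooth_on L f gf E \<and> is_arg_min f (\<lambda>u. u \<in> E) xstar \<and>
    \<mu> > 0 \<and> strongly_convex_C1_on \<mu> \<psi> g\<psi> E \<and> conjugate_gradient E \<psi> D \<and>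
    (\<forall>i. a i > 0) \<and> (\<forall>k. A k = (\<Sum>i\<le>k. a i)) \<and>
    0 < c \<and> c < 1 \<and> (\<forall>i\<ge>1. H i > 0 \<and> (a i)\<^sup>2 / (A i)\<^sup>2 = c * (\<mu> / (L * H i))) \<and>
    momentum_iterates E gf L D a A H x y z
    \<longrightarrow>
    ((\<forall>i\<ge>1. \<mu> / (L * H i) = 1) \<longrightarrow>
      (\<forall>k\<ge>1. (MIN i\<in>{1..k}. (dual_norm E (gf (x i)))\<^sup>2)
               \<le> C * (L * (f (x 0) - f xstar) / (c * (1 - c) * real k))) \<and>
      (c = 1 / 2 \<longrightarrow>
        (\<forall>k\<ge>1. (MIN i\<in>{1..k}. (dual_norm E (gf (x i)))\<^sup>2)
                 \<le> C * (L * (f (x 0) - f xstar) / real k))))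
    \<and>
    (convex_on E f \<and> (\<exists>lam. 0 \<le> lam \<and> lam \<le> 2 \<and> (\<forall>i\<ge>1. H i = A i powr lam)) \<longrightarrow>
      (\<forall>k\<ge>1. (MIN i\<in>{1..k}. (dual_norm E (gf (x i)))\<^sup>2)
               \<le> C * (L * (f (x 0) - f xstar) / (c * (1 - c) * real k))) \<and>
      (c = 1 / 2 \<longrightarrow>
        (\<forall>k\<ge>1. (MIN i\<in>{1..k}. (dual_norm E (gf (x i)))\<^sup>2)
                 \<le> C * (L * (f (x 0) - f xstar) / real k))))"
proof (intro exI[of _ 4] conjI allI impI; (elim conjE exE)?)
  show "(0::real) < 4" by simp
next
  fix E :: "'a set" and f g L xstar \<psi> g\<psi> \<mu> D
    and a A H :: "nat \<Rightarrow> real" and c x y z and k :: nat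
  assume hyps: "finite_dim_subspace E" "L > 0" "L_smooth_on L f g E"
      "is_arg_min f (\<lambda>u. u \<in> E) xstar" "\<mu> > 0" "strongly_convex_C1_on \<mu> \<psi> g\<psi> E"
      "conjugate_gradient E \<psi> D" "\<forall>i. a i > 0" "\<forall>k. A k = (\<Sum>i\<le>k. a i)" "0 < c" "c < 1"
      "\<forall>i\<ge>1. H i > 0 \<and> (a i)\<^sup>2 / (A i)\<^sup>2 = c * (\<mu> / (L * H i))"
      "momentum_iterates E g L D a A H x y z"
    and k: "k \<ge> 1"
  have "subspace E"
    using hyps(1) unfolding finite_dim_subspace_def by auto
  then interpret momentum_method E \<psi> g\<psi> \<mu> D f g L xstar a A H c x y z
    using hyps by unfold_locales auto
  {
    assume "\<forall>i\<ge>1. \<mu> / (L * H i) = 1"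
    then have B: "(MIN i\<in>{1..k}. (dual_norm E (g (x i)))\<^sup>2)
        \<le> 2 * L * (f (x 0) - f xstar) / ((1 - c) * real k)"
      using k by (intro nonconvex_bound) auto
    show "(MIN i\<in>{1..k}. (dual_norm E (g (x i)))\<^sup>2)
        \<le> 4 * (L * (f (x 0) - f xstar) / (c * (1 - c) * real k))"
      using k B by (rule rate_forms)
    show "(MIN i\<in>{1..k}. (dual_norm E (g (x i)))\<^sup>2) \<le> 4 * (L * (f (x 0) - f xstar) / real k)"
      if "c = 1 / 2"
      using k B that by (rule rate_forms)
  }
  {
    fix lam assume "convex_on E f" "0 \<le> lam" "\<forall>i\<ge>1. H i = A i powr lam"
    then have B: "(MIN i\<in>{1..k}. (dual_norm E (g (x i)))\<^sup>2)
        \<le> 2 * L * (f (x 0) - f xstar) / ((1 - c) * real k)"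
      using k by (intro convex_bound H_mono_of_powr[of lam]) auto
    show "(MIN i\<in>{1..k}. (dual_norm E (g (x i)))\<^sup>2)
        \<le> 4 * (L * (f (x 0) - f xstar) / (c * (1 - c) * real k))"
      using k B by (rule rate_forms)
    show "(MIN i\<in>{1..k}. (dual_norm E (g (x i)))\<^sup>2) \<le> 4 * (L * (f (x 0) - f xstar) / real k)"
      if "c = 1 / 2"
      using k B that by (rule rate_forms)
  }
qed

end
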